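(* No non-negative integer of the form $4k+3$ ($k\in\mathbb{N}_0$) can be represented in the form $4p_l+g_m+g_n$ with $l,m,n\in\mathbb{Z}$.
   Context: $\mathbb{N}_0=\{0,1,2,\dots\}$. $p_n=n(3n+1)/2$ (generalized pentagonal numbers) and $g_n=n(3n+2)$ (generalized octagonal numbers), $n\in\mathbb{Z}$. *)

theory Defs
  imports Main
begin

definition gen_pentagonal :: "int \<Rightarrow> int" where
  "gen_pentagonal n = n * (3 * n + 1) div 2"

(* The integer division above is exact. *)
lemma two_times_gen_pentagonal: "2 * gen_pentagonal n = n * (3 * n + 1)"
proof -
  have "even (n * (3 * n + 1))" by simp
  then show ?thesis unfolding gen_pentagonal_def by (rule dvd_mult_div_cancel)
qed

definition gen_octagonal :: "int \<Rightarrow> int" where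
  "gen_octagonal n = n * (3 * n + 2)"

end

theory Submission
  imports Defs
begin

text \<open>The obstruction is modulo 4. The term \<open>4 * gen_pentagonal l\<close> vanishes
  there, and by \<open>gen_octagonal_mod_4\<close> each generalized octagonal number leaves residue
  0 or 1. Two of them therefore add up to 0, 1 or 2, never to 3.\<close>

text \<open>Conceptually, n(3n+2) is congruent to 1 - (n-1)^2 modulo 4, and a square is 0 or 1
  modulo 4 according to its parity. The proof expands the two parity cases directly.\<close>

lemma gen_octagonal_mod_4: "gen_octagonal n mod 4 = n mod 2"
proof (cases "even n")
  case True
  then obtain c where "n = 2 * c" by (elim evenE)
  then have "gen_octagonal n = 4 * (c * (3 * c + 1))"
    by (simp add: gen_octagonal_def algebra_simps)
  with True show ?thesis by (simp add: even_iff_mod_2_eq_zero)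
next
  case False
  then obtain c where "n = 2 * c + 1" by (elim oddE)
  then have "gen_octagonal n = 1 + 4 * (3 * c\<^sup>2 + 4 * c + 1)"
    by (simp add: gen_octagonal_def algebra_simps power2_eq_square)
  then have "gen_octagonal n mod 4 = 1" by (simp only: mod_mult_self2) simp
  with False show ?thesis by (simp add: odd_iff_mod_2_eq_one)
qed

theorem corollary5p10p1:
  fixes k :: nat
  shows "\<not> (\<exists>l m n :: int.
    4 * int k + 3 = 4 * gen_pentagonal l + gen_octagonal m + gen_octagonal n)"
proof
  assume "\<exists>l m n :: int.
    4 * int k + 3 = 4 * gen_pentagonal l + gen_octagonal m + gen_octagonal n"
  then obtain l m n where
    eq: "4 * int k + 3 = 4 * gen_pentagonal l + gen_octagonal m + gen_octagonal n" by blast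
  have small: "gen_octagonal j mod 4 \<in> {0, 1}" for j
    unfolding gen_octagonal_mod_4 by auto
  \<comment> \<open>Collecting \<open>k\<close> and the pentagonal term into a single multiple of 4
    lets \<open>mod_mult_self2\<close> discard both at once.\<close>
  have "(gen_octagonal m + gen_octagonal n) mod 4 = (3 + 4 * (int k - gen_pentagonal l)) mod 4"
    using eq by (simp add: algebra_simps)
  also have "\<dots> = 3" by (simp only: mod_mult_self2) simp
  finally have "(gen_octagonal m mod 4 + gen_octagonal n mod 4) mod 4 = 3"
    by (simp only: mod_add_eq)
  \<comment> \<open>Only four pairs of residues remain, and none has sum 3.\<close>
  with small[of m] small[of n] show False by auto
qed

end
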